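(* Let $L:A\to A$ be a derivation and $q\in A$. Then every $\chi_0\in A$ determines a coset $\chi_0+\operatorname{Ker}(L+q)$ of the subgroup $\operatorname{Ker}(L+q)$ in the additive group $A$ on which the operator $L+q$ is constant.
   Context: $A$ is a field of characteristic $0$, and $K\cong\mathbb{Q}$ is its subfield generated by $1$. $A$ is generated as a field by a set $\{x_1,\dots,x_n\}$ of $n$ distinct elements, different from $0$ and $1$, which is algebraically independent over $K$. $A$ is also assumed to carry a partial order $\le$ such that $\psi_1>\psi_2$ and $\varphi_1\ge\varphi_2$ imply $\psi_1+\varphi_1>\psi_2+\varphi_2$, and $\psi^2\ge 0$ for all $\psi\in A$. A derivation is a $K$-linear map $L:A\to A$ with $L(\psi\varphi)=\psi L\varphi+\varphi L\psi$. For $q\in A$, the operator $L+q:A\to A$ is $(L+q)\psi=L\psi+q\psi$, and $\operatorname{Ker}(L+q)=\{\psi\in A:(L+q)\psi=0\}$. *)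

theory Defs
  imports "HOL-Algebra.Algebra"
begin

abbreviation prime_subfield :: "('a, 'b) ring_scheme \<Rightarrow> 'a set"
  where "prime_subfield R \<equiv> generate_field R {\<one>\<^bsub>R\<^esub>}"

(* An element of indexed_pset I K is a polynomial over K in the letters I, given by its coefficient
   function on monomials. It has finite support, so the finsum below is a genuine finite sum. *)
definition indexed_value ::
    "('a, 'b) ring_scheme \<Rightarrow> 'i set \<Rightarrow> ('i \<Rightarrow> 'a) \<Rightarrow> ('i multiset \<Rightarrow> 'a) \<Rightarrow> 'a"
  where "indexed_value R I x P =
    (\<Oplus>\<^bsub>R\<^esub> m \<in> {m. P m \<noteq> \<zero>\<^bsub>R\<^esub>}. P m \<otimes>\<^bsub>R\<^esub> (\<Otimes>\<^bsub>R\<^esub> i \<in> I. x i [^]\<^bsub>R\<^esub> count m i))"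

definition algebraically_independent ::
    "('a, 'b) ring_scheme \<Rightarrow> 'a set \<Rightarrow> 'i set \<Rightarrow> ('i \<Rightarrow> 'a) \<Rightarrow> bool"
  where "algebraically_independent R K I x \<longleftrightarrow>
    (\<forall>P \<in> ring.indexed_pset R I K.
      indexed_value R I x P = \<zero>\<^bsub>R\<^esub> \<longrightarrow> P = ring.indexed_const R \<zero>\<^bsub>R\<^esub>)"

(* (a, b) \<in> leq means a \<le> b. *)
locale ordered_function_field = field A for A (structure) +
  fixes n :: nat and x :: "nat \<Rightarrow> 'a" and leq :: "'a rel"
  assumes char_zero: "\<And>k::nat. 0 < k \<Longrightarrow> [k] \<cdot> \<one> \<noteq> \<zero>"
    and generators: "x ` {1..n} \<subseteq> carrier A - {\<zero>, \<one>}"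
    and distinct_generators: "inj_on x {1..n}"
    and generated: "generate_field A (x ` {1..n}) = carrier A"
    and independent_generators:
      "algebraically_independent A (prime_subfield A) {1..n} x"
    and partial_order: "partial_order_on (carrier A) leq"
    and strict_add_mono:
      "\<And>\<psi>1 \<psi>2 \<phi>1 \<phi>2. \<lbrakk>(\<psi>2, \<psi>1) \<in> leq; \<psi>2 \<noteq> \<psi>1; (\<phi>2, \<phi>1) \<in> leq\<rbrakk> \<Longrightarrow>
        (\<psi>2 \<oplus> \<phi>2, \<psi>1 \<oplus> \<phi>1) \<in> leq \<and> \<psi>2 \<oplus> \<phi>2 \<noteq> \<psi>1 \<oplus> \<phi>1"
    and square_nonneg: "\<And>\<psi>. \<psi> \<in> carrier A \<Longrightarrow> (\<zero>, \<psi> [^] (2::nat)) \<in> leq"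

definition derivation :: "('a, 'b) ring_scheme \<Rightarrow> ('a \<Rightarrow> 'a) \<Rightarrow> bool"
  where "derivation R L \<longleftrightarrow>
    L \<in> carrier R \<rightarrow> carrier R \<and>
    (\<forall>\<psi> \<in> carrier R. \<forall>\<phi> \<in> carrier R. L (\<psi> \<oplus>\<^bsub>R\<^esub> \<phi>) = L \<psi> \<oplus>\<^bsub>R\<^esub> L \<phi>) \<and>
    (\<forall>c \<in> prime_subfield R. \<forall>\<psi> \<in> carrier R. L (c \<otimes>\<^bsub>R\<^esub> \<psi>) = c \<otimes>\<^bsub>R\<^esub> L \<psi>) \<and>
    (\<forall>\<psi> \<in> carrier R. \<forall>\<phi> \<in> carrier R.
      L (\<psi> \<otimes>\<^bsub>R\<^esub> \<phi>) = \<psi> \<otimes>\<^bsub>R\<^esub> L \<phi> \<oplus>\<^bsub>R\<^esub> \<phi> \<otimes>\<^bsub>R\<^esub> L \<psi>)"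

definition shifted_op :: "('a, 'b) ring_scheme \<Rightarrow> ('a \<Rightarrow> 'a) \<Rightarrow> 'a \<Rightarrow> 'a \<Rightarrow> 'a"
  where "shifted_op R L q \<psi> = L \<psi> \<oplus>\<^bsub>R\<^esub> q \<otimes>\<^bsub>R\<^esub> \<psi>"

abbreviation Ker :: "('a, 'b) ring_scheme \<Rightarrow> ('a \<Rightarrow> 'a) \<Rightarrow> 'a set"
  where "Ker R T \<equiv> a_kernel R R T"

end

theory Submission
  imports Defs
begin

text \<open>The operator \<open>L + q\<close> is an endomorphism of the additive group of \<open>A\<close>: it is additive
  because \<open>L\<close> is additive and multiplication distributes over addition. So its kernel is a
  subgroup, and it takes the value \<open>(L + q) \<chi>0\<close> on the whole coset of \<open>\<chi>0\<close>.\<close>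

lemma (in ring) shifted_op_abelian_group_hom:
  assumes "derivation R L" and "q \<in> carrier R"
  shows "abelian_group_hom R R (shifted_op R L q)"
proof (rule abelian_group_homI)
  show "abelian_group R" "abelian_group R"
    by (rule abelian_group_axioms)+
  have L_closed: "L \<psi> \<in> carrier R" if "\<psi> \<in> carrier R" for \<psi>
    using assms(1) that by (auto simp: derivation_def)
  have L_add: "L (\<psi> \<oplus> \<phi>) = L \<psi> \<oplus> L \<phi>" if "\<psi> \<in> carrier R" "\<phi> \<in> carrier R" for \<psi> \<phi>
    using assms(1) that by (auto simp: derivation_def)
  have "shifted_op R L q \<in> hom (add_monoid R) (add_monoid R)"
  proof (rule homI)
    fix \<psi> \<phi>
    assume "\<psi> \<in> carrier (add_monoid R)" "\<phi> \<in> carrier (add_monoid R)"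
    then have "\<psi> \<in> carrier R" "\<phi> \<in> carrier R"
      by simp_all
    with assms(2) show "shifted_op R L q (\<psi> \<otimes>\<^bsub>add_monoid R\<^esub> \<phi>) =
        shifted_op R L q \<psi> \<otimes>\<^bsub>add_monoid R\<^esub> shifted_op R L q \<phi>"
      by (simp add: shifted_op_def L_add L_closed r_distr a_ac)
  qed (use assms(2) in \<open>simp add: shifted_op_def L_closed\<close>)
  then show "group_hom (add_monoid R) (add_monoid R) (shifted_op R L q)"
    by (intro group_hom.intro group_hom_axioms.intro a_group)
qed

lemma (in abelian_group_hom) hom_const_on_a_kernel_coset:
  assumes "x \<in> carrier G" and "y \<in> x <+\<^bsub>G\<^esub> a_kernel G H h"
  shows "h y = h x"
proof -
  from assms(2) obtain k where "k \<in> carrier G" "h k = \<zero>\<^bsub>H\<^esub>" "y = x \<oplus>\<^bsub>G\<^esub> k"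
    unfolding a_l_coset_def' a_kernel_def' by blast
  with assms(1) show ?thesis
    by simp
qed

theorem mainTheorem10:
  fixes A (structure) and n :: nat and x :: "nat \<Rightarrow> 'a" and leq :: "'a rel"
    and L :: "'a \<Rightarrow> 'a" and q :: 'a
  assumes "ordered_function_field A n x leq"
    and "derivation A L"
    and "q \<in> carrier A"
  shows "additive_subgroup (Ker A (shifted_op A L q)) A \<and>
    (\<forall>\<chi>0 \<in> carrier A.
      \<chi>0 <+ Ker A (shifted_op A L q) \<in> a_rcosets (Ker A (shifted_op A L q)) \<and>
      (\<exists>c \<in> carrier A. \<forall>\<psi> \<in> \<chi>0 <+ Ker A (shifted_op A L q). shifted_op A L q \<psi> = c))"
proof -
  interpret field A
    using assms(1) by (rule ordered_function_field.axioms)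
  interpret T: abelian_group_hom A A "shifted_op A L q"
    using assms(2,3) by (rule shifted_op_abelian_group_hom)
  have subgroup: "additive_subgroup (Ker A (shifted_op A L q)) A"
    by (rule T.additive_subgroup_a_kernel)
  \<comment> \<open>The quotient consists of right cosets; left and right cosets agree, as addition commutes.\<close>
  have left_eq_right:
    "\<chi> <+ Ker A (shifted_op A L q) = Ker A (shifted_op A L q) +> \<chi>" if "\<chi> \<in> carrier A" for \<chi>
    using abelian_subgroup.a_coset_eq[OF T.abelian_subgroup_a_kernel] that by simp
  have "\<chi> <+ Ker A (shifted_op A L q) \<in> a_rcosets (Ker A (shifted_op A L q))"
    if "\<chi> \<in> carrier A" for \<chi>
    using that additive_subgroup.a_subset[OF subgroup]
    by (simp add: left_eq_right a_rcosetsI)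
  moreover have "\<exists>c \<in> carrier A. \<forall>\<psi> \<in> \<chi> <+ Ker A (shifted_op A L q). shifted_op A L q \<psi> = c"
    if "\<chi> \<in> carrier A" for \<chi>
  proof (rule bexI)
    show "\<forall>\<psi> \<in> \<chi> <+ Ker A (shifted_op A L q). shifted_op A L q \<psi> = shifted_op A L q \<chi>"
      using that by (intro ballI T.hom_const_on_a_kernel_coset)
    show "shifted_op A L q \<chi> \<in> carrier A"
      using that by (rule T.hom_closed)
  qed
  ultimately show ?thesis
    by (intro conjI ballI subgroup)
qed

end
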